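(* For any $p>0$ and $\epsilon\in(0,0.9)$, any $O(1)$-pass $(1+\epsilon,0.49)$-$L_{M_p}$-sampler (in the node-arrival streaming model) on a data stream of length $n$ needs $\Omega\left(n^{1-1/(p+1)}\right)$ bits of space.
   Context: Similarity graph. $U$ is a universe of items and $f:U\times U\to[0,1]$ is a symmetric similarity function with $f(x,x)=1$ for all $x\in U$. For a stream $\sigma=(\sigma_1,\dots,\sigma_n)\in U^n$, the degree of node $i\in[n]$ in the similarity graph $G^\sigma$ (complete graph on $[n]$ with self-loops, weights $w(i,j)=f(\sigma_i,\sigma_j)$) is $d_i=\sum_{j\in[n]} f(\sigma_i,\sigma_j)$, and $M_p(\sigma)=\sum_{i\in[n]} d_i^p$. Each stream position is a distinct node; node $i$ is represented by the pair $(i,\sigma_i)$. Sampler. A $(1+\epsilon,\delta)$-$L_{M_p}$-sampler on $G^\sigma$ fails with probability at most $\delta$ and, conditioned on no failure, outputs node $i$ with a probability $p_i$ satisfying $(1-\epsilon)\frac{d_i^{p}}{M_p(\sigma)}\le p_i\le(1+\epsilon)\frac{d_i^{p}}{M_p(\sigma)}$, for every $i\in[n]$. Node-arrival streaming model. The items $\sigma_1,\dots,\sigma_n$ arrive sequentially and the algorithm, which has access to $f$, makes one or more linear scans (passes) over them while maintaining a bounded memory state. Algorithms are randomized; the algorithm's guarantee is required for every universe $U$, every similarity function $f$ and every stream $\sigma$ of length $n$, and its space is the worst-case number of bits of memory. Throughout, $p$ is a constant; the constant hidden in $\Omega(\cdot)$ may depend on $p$ and on the constant number of passes. *)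

theory Defs
  imports "HOL-Probability.Probability"
begin

section \<open>Similarity graphs\<close>

text \<open>
  A universe is a set of items coded as natural numbers.  Algorithms below are required to work
  for every such universe; asking nothing of them for uncountable universes only enlarges the
  class of algorithms to which a lower bound applies.
\<close>

definition similarity :: "nat set \<Rightarrow> (nat \<Rightarrow> nat \<Rightarrow> real) \<Rightarrow> bool" where
  "similarity U f \<longleftrightarrow>
     (\<forall>x\<in>U. \<forall>y\<in>U. 0 \<le> f x y \<and> f x y \<le> 1 \<and> f x y = f y x) \<and> (\<forall>x\<in>U. f x x = 1)"

definition streams_of :: "nat set \<Rightarrow> nat \<Rightarrow> nat list set" where
  "streams_of U n = {\<sigma>. set \<sigma> \<subseteq> U \<and> length \<sigma> = n}"

text \<open>Nodes are the positions \<open>0, \<dots>, n - 1\<close>; the sum includes the self-loop \<open>j = i\<close>.\<close>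

definition degree :: "(nat \<Rightarrow> nat \<Rightarrow> real) \<Rightarrow> nat list \<Rightarrow> nat \<Rightarrow> real" where
  "degree f \<sigma> i = (\<Sum>j<length \<sigma>. f (\<sigma> ! i) (\<sigma> ! j))"

definition moment :: "(nat \<Rightarrow> nat \<Rightarrow> real) \<Rightarrow> real \<Rightarrow> nat list \<Rightarrow> real" where
  "moment f p \<sigma> = (\<Sum>i<length \<sigma>. degree f \<sigma> i powr p)"


section \<open>Multi-pass streaming algorithms\<close>

text \<open>
  The memory is a bit string, and a transition sees only the memory, the arriving item and a clock
  (from which the pass and the position can be computed).  Private coins are tossed in each
  transition and in the output map.  The clock is not charged to the memory.  An output is a node
  \<open>(i, \<sigma> ! i)\<close>, or \<open>None\<close> for failure.
\<close>

record machine =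
  passes :: nat
  start :: "bool list pmf"
  step :: "nat \<Rightarrow> nat \<Rightarrow> bool list \<Rightarrow> bool list pmf"
  out :: "bool list \<Rightarrow> (nat \<times> nat) option pmf"

text \<open>The memory contents after \<open>t\<close> items have been read, scanning \<open>\<sigma>\<close> cyclically.\<close>

primrec memory :: "machine \<Rightarrow> nat list \<Rightarrow> nat \<Rightarrow> bool list pmf" where
  "memory M \<sigma> 0 = start M"
| "memory M \<sigma> (Suc t) = memory M \<sigma> t \<bind> step M t (\<sigma> ! (t mod length \<sigma>))"

definition run :: "machine \<Rightarrow> nat list \<Rightarrow> (nat \<times> nat) option pmf" where
  "run M \<sigma> = memory M \<sigma> (passes M * length \<sigma>) \<bind> out M"

text \<open>
  An algorithm has unrestricted access to the universe and to the similarity function, so these are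
  parameters.  It may in addition choose its machine at random once and for all: this is a shared
  random string that is not charged to the memory.  An algorithm without it is a point mass.
\<close>

type_synonym algorithm = "nat set \<Rightarrow> (nat \<Rightarrow> nat \<Rightarrow> real) \<Rightarrow> machine pmf"

definition result :: "algorithm \<Rightarrow> nat set \<Rightarrow> (nat \<Rightarrow> nat \<Rightarrow> real) \<Rightarrow> nat list \<Rightarrow> (nat \<times> nat) option pmf" where
  "result A U f \<sigma> = A U f \<bind> (\<lambda>M. run M \<sigma>)"

definition passes_at_most :: "nat \<Rightarrow> algorithm \<Rightarrow> bool" where
  "passes_at_most k A \<longleftrightarrow>
     (\<forall>U f. similarity U f \<longrightarrow> (\<forall>M\<in>set_pmf (A U f). 1 \<le> passes M \<and> passes M \<le> k))"

text \<open>
  Worst-case space, over all coin tosses and over all streams of length \<open>n\<close> and all similarity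
  functions on universes of at most \<open>u\<close> items.  The size of the universe has to be a parameter:
  every sampler needs memory growing with it, even for fixed \<open>n\<close> (for \<open>n = 1\<close> the output
  identifies the item), so that no number of bits depending on \<open>n\<close> alone bounds the space on all
  universes.
\<close>

definition space_at_most :: "nat \<Rightarrow> nat \<Rightarrow> algorithm \<Rightarrow> nat \<Rightarrow> bool" where
  "space_at_most n u A s \<longleftrightarrow>
     (\<forall>U f. similarity U f \<longrightarrow> finite U \<longrightarrow> card U \<le> u \<longrightarrow>
       (\<forall>\<sigma>\<in>streams_of U n. \<forall>M\<in>set_pmf (A U f). \<forall>t\<le>passes M * n.
          \<forall>m\<in>set_pmf (memory M \<sigma> t). length m \<le> s))"


section \<open>Samplers\<close>

definition sampler :: "nat \<Rightarrow> real \<Rightarrow> real \<Rightarrow> real \<Rightarrow> algorithm \<Rightarrow> bool" where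
  "sampler n p \<epsilon> \<delta> A \<longleftrightarrow>
     (\<forall>U f. similarity U f \<longrightarrow> (\<forall>\<sigma>\<in>streams_of U n.
        set_pmf (result A U f \<sigma>) \<subseteq> {None} \<union> {Some (i, \<sigma> ! i) | i. i < n} \<and>
        pmf (result A U f \<sigma>) None \<le> \<delta> \<and>
        (\<forall>i<n.
           let p\<^sub>i = \<P>(z in measure_pmf (result A U f \<sigma>). z = Some (i, \<sigma> ! i) \<bar> z \<noteq> None);
               q\<^sub>i = degree f \<sigma> i powr p / moment f p \<sigma>
           in (1 - \<epsilon>) * q\<^sub>i \<le> p\<^sub>i \<and> p\<^sub>i \<le> (1 + \<epsilon>) * q\<^sub>i)))"

end

theory Submission
  imports Defs "HOL-Real_Asymp.Real_Asymp"
begin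

text \<open>
  The bound is a reduction from searching the unique common element of two sets.  Put
  \<open>m = \<lceil>n powr (1 / (p + 1))\<rceil>\<close> and \<open>N = n div (2 * m)\<close>.  The first \<open>m * N\<close> positions encode a set
  \<open>X \<subseteq> {..<N}\<close> and the next \<open>m * N\<close> positions a set \<open>Y \<subseteq> {..<N}\<close>, each index being a block of \<open>m\<close>
  positions, in such a way that the only edges are complete bipartite graphs \<open>K\<^sub>m\<^sub>,\<^sub>m\<close> between the
  blocks of the indices in \<open>X \<inter> Y\<close>.  If \<open>X \<inter> Y = {i}\<close>, then the two blocks of \<open>i\<close> carry
  \<open>2 * m * (m + 1) powr p \<ge> n\<close> of the moment and hence at least half of it, so a sampler finds \<open>i\<close>
  with constant probability.

  For fixed public coins the memory contents at the times when the scan changes from the \<open>X\<close>-part to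
  the \<open>Y\<close>-part or back form a transcript \<open>t\<close> whose probability is a product \<open>a t X * b t Y\<close>.  Such
  a transcript cannot localise the intersection unless it takes \<open>2 ^ \<Omega>(N)\<close> values.  Draw a partition
  of the indices into a part that only \<open>X\<close> may meet and a part that only \<open>Y\<close> may meet, and then a
  uniform set of indices.  By the level-1 inequality, the squared Hellinger distances between the
  transcripts with the \<open>i\<close>-th bit off and on sum up to \<open>O (ln card T)\<close>.  By the cut-and-paste property
  of products, the transcripts for \<open>i \<in> X \<inter> Y\<close> and for \<open>i \<notin> X \<union> Y\<close> are then equally close, while in
  the latter case the index \<open>i\<close> is guessed with average probability \<open>O (1 / N)\<close>.
\<close>

section \<open>Level-1 inequality and cut-and-paste\<close>

text \<open>Hoeffding's bound for a fair random sign. The auxiliary inequality at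
  \<open>2 * x\<close> with weight \<open>1 / 2\<close> gives the case \<open>x \<ge> 0\<close>;
  symmetry gives the rest.\<close>

lemma exp_add_exp_minus_le: "exp x + exp (- x) \<le> 2 * exp (x\<^sup>2 / 2)" for x :: real
proof -
  have *: "exp x + exp (- x) \<le> 2 * exp (x\<^sup>2 / 2)" if "x \<ge> 0" for x :: real
  proof -
    have "- x + ln ((1 + exp (2 * x)) / 2) \<le> x\<^sup>2 / 2"
      using Hoeffdings_lemma_aux[of "2 * x" "1 / 2"] that
      by (simp add: power2_eq_square field_simps)
    then have "ln ((1 + exp (2 * x)) / 2) \<le> x + x\<^sup>2 / 2"
      by simp
    then have "(1 + exp (2 * x)) / 2 \<le> exp (x + x\<^sup>2 / 2)"
      by (subst ln_le_cancel_iff [symmetric]) (auto intro: add_pos_pos)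
    then have "exp (- x) * (1 + exp (2 * x)) \<le> exp (- x) * (2 * exp (x + x\<^sup>2 / 2))"
      by (intro mult_left_mono) auto
    then show ?thesis
      by (simp add: algebra_simps flip: exp_add)
  qed
  show ?thesis
    using *[of x] *[of "- x"] by (cases "x \<ge> 0") (auto simp: add.commute)
qed

lemma sum_Pow_remove:
  assumes "finite Q" "i \<in> Q"
  shows "(\<Sum>Z\<in>Pow Q. h Z) = (\<Sum>Z\<in>Pow (Q - {i}). h Z + h (insert i Z))"
proof -
  have "Pow Q = Pow (Q - {i}) \<union> insert i ` Pow (Q - {i})"
    using Pow_insert[of i "Q - {i}"] assms(2) by (simp add: insert_absorb)
  moreover have "inj_on (insert i) (Pow (Q - {i}))"
    by (auto simp: inj_on_def)
  ultimately show ?thesis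
    using assms(1) by (simp add: sum.union_disjoint sum.reindex disjoint_iff sum.distrib)
      (subst sum.union_disjoint; auto simp: sum.reindex)
qed

text \<open>
  The proof compares the tilted sums of \<open>exp (L Z / s)\<close> under \<open>g\<close> (from below, by Jensen's inequality)
  and under the uniform weight (from above, by independence of the coordinates).
\<close>

lemma level_one_inequality:
  fixes g :: "'a set \<Rightarrow> real"
  assumes "finite Q" and g: "\<And>Z. Z \<subseteq> Q \<Longrightarrow> 0 \<le> g Z" "\<And>Z. Z \<subseteq> Q \<Longrightarrow> g Z \<le> 1"
    and s: "s = (\<Sum>Z\<in>Pow Q. g Z)" "s > 0"
    and d: "\<And>i. i \<in> Q \<Longrightarrow> d i = (\<Sum>Z\<in>Pow (Q - {i}). g (insert i Z) - g Z)"
  shows "(\<Sum>i\<in>Q. (d i)\<^sup>2) \<le> 2 * s\<^sup>2 * ln (2 ^ card Q / s)"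
proof -
  define sg :: "'a \<Rightarrow> 'a set \<Rightarrow> real" where "sg i Z = (if i \<in> Z then 1 else - 1)" for i Z
  define L where "L Z = (\<Sum>i\<in>Q. d i * sg i Z)" for Z
  define W where "W = (\<Sum>i\<in>Q. (d i)\<^sup>2)"
  have d': "(\<Sum>Z\<in>Pow Q. g Z * sg i Z) = d i" if "i \<in> Q" for i
    unfolding d[OF that] sum_Pow_remove[OF assms(1) that]
    by (intro sum.cong) (auto simp: sg_def)
  have gL: "(\<Sum>Z\<in>Pow Q. g Z * L Z) = W"
  proof -
    have "(\<Sum>Z\<in>Pow Q. g Z * L Z) = (\<Sum>i\<in>Q. d i * (\<Sum>Z\<in>Pow Q. g Z * sg i Z))"
      unfolding L_def sum_distrib_left by (subst sum.swap) (simp add: ac_simps)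
    then show ?thesis by (simp add: d' W_def power2_eq_square)
  qed
  \<comment> \<open>\<open>c\<close> is the mean of \<open>L Z / s\<close> under the weight
    \<open>g\<close> normalised by \<open>s\<close>; the tangent of \<open>exp\<close> at this point
    yields Jensen's inequality.\<close>
  define c where "c = W / s\<^sup>2"
  have "s * exp c = (\<Sum>Z\<in>Pow Q. g Z * (exp c * (1 + (L Z / s - c))))"
  proof -
    have "(\<Sum>Z\<in>Pow Q. g Z * (exp c * (1 + (L Z / s - c))))
        = exp c * ((1 - c) * (\<Sum>Z\<in>Pow Q. g Z) + (\<Sum>Z\<in>Pow Q. g Z * L Z) / s)"
      by (simp add: sum_distrib_left sum_divide_distrib algebra_simps flip: sum.distrib sum_subtractf)
    also have "\<dots> = exp c * s"
      unfolding gL s(1)[symmetric] c_def using s(2) by (simp add: field_simps power2_eq_square)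
    finally show ?thesis by simp
  qed
  also have "\<dots> \<le> (\<Sum>Z\<in>Pow Q. exp (L Z / s))"
  proof (rule sum_mono)
    fix Z assume Z: "Z \<in> Pow Q"
    have "exp c * (1 + (L Z / s - c)) \<le> exp c * exp (L Z / s - c)"
      by (intro mult_left_mono exp_ge_add_one_self) auto
    also have "\<dots> = exp (L Z / s)" by (simp flip: exp_add)
    finally have "g Z * (exp c * (1 + (L Z / s - c))) \<le> g Z * exp (L Z / s)"
      using g Z by (intro mult_left_mono) auto
    also have "\<dots> \<le> 1 * exp (L Z / s)"
      using g Z by (intro mult_right_mono) auto
    finally show "g Z * (exp c * (1 + (L Z / s - c))) \<le> exp (L Z / s)" by simp
  qed
  also have "\<dots> = (\<Sum>Z\<in>Pow Q. (\<Prod>i\<in>Z. exp (d i / s)) * (\<Prod>i\<in>Q - Z. exp (- (d i / s))))"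
  proof (rule sum.cong)
    fix Z assume "Z \<in> Pow Q"
    then have "L Z / s = (\<Sum>i\<in>Z. d i / s) + (\<Sum>i\<in>Q - Z. - (d i / s))"
      unfolding L_def sum_divide_distrib using assms(1)
      by (subst sum.subset_diff[of Z Q]) (auto simp: sg_def intro!: arg_cong2[where f = "(+)"] sum.cong)
    moreover have "finite Z" using \<open>Z \<in> Pow Q\<close> assms(1) by (auto intro: finite_subset)
    ultimately show "exp (L Z / s) = (\<Prod>i\<in>Z. exp (d i / s)) * (\<Prod>i\<in>Q - Z. exp (- (d i / s)))"
      using assms(1) by (simp only: exp_add exp_sum finite_Diff)
  qed simp
  also have "\<dots> = (\<Prod>i\<in>Q. exp (d i / s) + exp (- (d i / s)))"
    using assms(1) by (simp add: prod_add)
  also have "\<dots> \<le> (\<Prod>i\<in>Q. 2 * exp ((d i / s)\<^sup>2 / 2))"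
    by (intro prod_mono conjI exp_add_exp_minus_le) (simp add: add_nonneg_nonneg)
  also have "\<dots> = 2 ^ card Q * exp (c / 2)"
    using assms(1)
    by (simp add: prod.distrib c_def W_def power_divide sum_divide_distrib flip: exp_sum)
  finally have "exp c / exp (c / 2) \<le> 2 ^ card Q / s"
    using s(2) by (simp add: field_simps)
  then have "exp (c / 2) \<le> 2 ^ card Q / s"
    by (simp flip: exp_diff)
  then have "c / 2 \<le> ln (2 ^ card Q / s)"
    using s(2) ln_ge_iff[of "2 ^ card Q / s" "c / 2"] by simp
  then show ?thesis
    using s(2) by (simp add: c_def W_def field_simps)
qed

text \<open>All four products have total mass \<open>E\<close>, so a squared Hellinger distance
  between two of them depends only on the sum of their geometric means. That sum is the same for the
  pair (1,1), (0,0) as for the pair (1,0), (0,1), and the latter pair is compared through (0,0). The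
  test \<open>w\<close> turns the distance into a bound on acceptance weights.\<close>

lemma cut_and_paste:
  fixes \<alpha>\<^sub>0 \<alpha>\<^sub>1 \<beta>\<^sub>0 \<beta>\<^sub>1 w :: "'t \<Rightarrow> real"
  assumes nn: "\<And>t. t \<in> T \<Longrightarrow> \<alpha>\<^sub>0 t \<ge> 0" "\<And>t. t \<in> T \<Longrightarrow> \<alpha>\<^sub>1 t \<ge> 0"
      "\<And>t. t \<in> T \<Longrightarrow> \<beta>\<^sub>0 t \<ge> 0" "\<And>t. t \<in> T \<Longrightarrow> \<beta>\<^sub>1 t \<ge> 0"
    and w: "\<And>t. t \<in> T \<Longrightarrow> 0 \<le> w t" "\<And>t. t \<in> T \<Longrightarrow> w t \<le> 1"
    and E: "(\<Sum>t\<in>T. \<alpha>\<^sub>0 t * \<beta>\<^sub>0 t) = E" "(\<Sum>t\<in>T. \<alpha>\<^sub>1 t * \<beta>\<^sub>0 t) = E"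
      "(\<Sum>t\<in>T. \<alpha>\<^sub>0 t * \<beta>\<^sub>1 t) = E" "(\<Sum>t\<in>T. \<alpha>\<^sub>1 t * \<beta>\<^sub>1 t) = E"
  shows "(\<Sum>t\<in>T. w t * (\<alpha>\<^sub>1 t * \<beta>\<^sub>1 t)) \<le> 2 * (\<Sum>t\<in>T. w t * (\<alpha>\<^sub>0 t * \<beta>\<^sub>0 t))
    + 4 * ((\<Sum>t\<in>T. (sqrt (\<alpha>\<^sub>1 t * \<beta>\<^sub>0 t) - sqrt (\<alpha>\<^sub>0 t * \<beta>\<^sub>0 t))\<^sup>2)
         + (\<Sum>t\<in>T. (sqrt (\<alpha>\<^sub>0 t * \<beta>\<^sub>1 t) - sqrt (\<alpha>\<^sub>0 t * \<beta>\<^sub>0 t))\<^sup>2))"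
proof -
  let ?H = "\<Sum>t\<in>T. (sqrt (\<alpha>\<^sub>1 t * \<beta>\<^sub>1 t) - sqrt (\<alpha>\<^sub>0 t * \<beta>\<^sub>0 t))\<^sup>2"
  have "?H = (\<Sum>t\<in>T. \<alpha>\<^sub>1 t * \<beta>\<^sub>1 t + \<alpha>\<^sub>0 t * \<beta>\<^sub>0 t - 2 * sqrt (\<alpha>\<^sub>0 t * \<alpha>\<^sub>1 t * \<beta>\<^sub>0 t * \<beta>\<^sub>1 t))"
    using nn by (intro sum.cong) (auto simp: power2_diff real_sqrt_mult power_mult_distrib)
  \<comment> \<open>the cross term is invariant under exchanging \<open>\<beta>\<^sub>0\<close> and \<open>\<beta>\<^sub>1\<close>\<close>
  also have "\<dots> = (\<Sum>t\<in>T. \<alpha>\<^sub>1 t * \<beta>\<^sub>0 t + \<alpha>\<^sub>0 t * \<beta>\<^sub>1 t - 2 * sqrt (\<alpha>\<^sub>0 t * \<alpha>\<^sub>1 t * \<beta>\<^sub>0 t * \<beta>\<^sub>1 t))"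
    by (simp add: sum.distrib sum_subtractf E)
  also have "\<dots> = (\<Sum>t\<in>T. (sqrt (\<alpha>\<^sub>1 t * \<beta>\<^sub>0 t) - sqrt (\<alpha>\<^sub>0 t * \<beta>\<^sub>1 t))\<^sup>2)"
    using nn by (intro sum.cong) (auto simp: power2_diff real_sqrt_mult power_mult_distrib)
  also have "\<dots> \<le> (\<Sum>t\<in>T. 2 * (sqrt (\<alpha>\<^sub>1 t * \<beta>\<^sub>0 t) - sqrt (\<alpha>\<^sub>0 t * \<beta>\<^sub>0 t))\<^sup>2
        + 2 * (sqrt (\<alpha>\<^sub>0 t * \<beta>\<^sub>1 t) - sqrt (\<alpha>\<^sub>0 t * \<beta>\<^sub>0 t))\<^sup>2)"
  proof (rule sum_mono)
    fix t
    have *: "(x - y)\<^sup>2 \<le> 2 * (x - z)\<^sup>2 + 2 * (y - z)\<^sup>2" for x y z :: real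
      using zero_le_power2[of "x + y - 2 * z"] by (simp add: power2_eq_square algebra_simps)
    show "(sqrt (\<alpha>\<^sub>1 t * \<beta>\<^sub>0 t) - sqrt (\<alpha>\<^sub>0 t * \<beta>\<^sub>1 t))\<^sup>2
      \<le> 2 * (sqrt (\<alpha>\<^sub>1 t * \<beta>\<^sub>0 t) - sqrt (\<alpha>\<^sub>0 t * \<beta>\<^sub>0 t))\<^sup>2
        + 2 * (sqrt (\<alpha>\<^sub>0 t * \<beta>\<^sub>1 t) - sqrt (\<alpha>\<^sub>0 t * \<beta>\<^sub>0 t))\<^sup>2"
      by (rule *)
  qed
  finally have H: "?H \<le> 2 * ((\<Sum>t\<in>T. (sqrt (\<alpha>\<^sub>1 t * \<beta>\<^sub>0 t) - sqrt (\<alpha>\<^sub>0 t * \<beta>\<^sub>0 t))\<^sup>2)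
         + (\<Sum>t\<in>T. (sqrt (\<alpha>\<^sub>0 t * \<beta>\<^sub>1 t) - sqrt (\<alpha>\<^sub>0 t * \<beta>\<^sub>0 t))\<^sup>2))"
    by (simp add: sum.distrib sum_distrib_left)
  have "(\<Sum>t\<in>T. w t * (\<alpha>\<^sub>1 t * \<beta>\<^sub>1 t))
      \<le> (\<Sum>t\<in>T. 2 * (w t * (\<alpha>\<^sub>0 t * \<beta>\<^sub>0 t)) + 2 * (sqrt (\<alpha>\<^sub>1 t * \<beta>\<^sub>1 t) - sqrt (\<alpha>\<^sub>0 t * \<beta>\<^sub>0 t))\<^sup>2)"
  proof (rule sum_mono)
    fix t assume t: "t \<in> T"
    let ?x = "sqrt (\<alpha>\<^sub>1 t * \<beta>\<^sub>1 t)" and ?y = "sqrt (\<alpha>\<^sub>0 t * \<beta>\<^sub>0 t)"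
    have "?x\<^sup>2 \<le> 2 * ?y\<^sup>2 + 2 * (?x - ?y)\<^sup>2"
      using zero_le_power2[of "?x - 2 * ?y"] by (simp add: power2_eq_square algebra_simps)
    then have "w t * ?x\<^sup>2 \<le> w t * (2 * ?y\<^sup>2 + 2 * (?x - ?y)\<^sup>2)"
      using w t by (intro mult_left_mono) auto
    also have "\<dots> \<le> 2 * (w t * ?y\<^sup>2) + 1 * (2 * (?x - ?y)\<^sup>2)"
      unfolding distrib_left using w t by (intro add_mono mult_right_mono) auto
    finally show "w t * (\<alpha>\<^sub>1 t * \<beta>\<^sub>1 t) \<le> 2 * (w t * (\<alpha>\<^sub>0 t * \<beta>\<^sub>0 t)) + 2 * (?x - ?y)\<^sup>2"
      using nn t by simp
  qed
  also have "\<dots> = 2 * (\<Sum>t\<in>T. w t * (\<alpha>\<^sub>0 t * \<beta>\<^sub>0 t)) + 2 * ?H"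
    by (simp add: sum.distrib sum_distrib_left)
  finally show ?thesis using H by linarith
qed

text \<open>The level-1 inequality is applied to each \<open>g t\<close>. What remains is the sum of
  \<open>s t * ln (2 ^ card Q / s t)\<close>, which for a fixed total of \<open>s\<close> is largest
  when all \<open>s t\<close> agree; this gives \<open>ln (card T)\<close>.\<close>

lemma sum_hellinger_le_ln_card:
  fixes g :: "'t \<Rightarrow> 'a set \<Rightarrow> real"
  assumes "finite Q" "finite T" "T \<noteq> {}"
    and nn: "\<And>t Z. t \<in> T \<Longrightarrow> Z \<subseteq> Q \<Longrightarrow> 0 \<le> g t Z"
    and one: "\<And>Z. Z \<subseteq> Q \<Longrightarrow> (\<Sum>t\<in>T. g t Z) = 1"
  shows "(\<Sum>i\<in>Q. \<Sum>t\<in>T. (sqrt (\<Sum>Z\<in>Pow (Q - {i}). g t (insert i Z))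
            - sqrt (\<Sum>Z\<in>Pow (Q - {i}). g t Z))\<^sup>2)
         \<le> 2 * 2 ^ card Q * ln (card T)"
proof -
  define P1 where "P1 i t = (\<Sum>Z\<in>Pow (Q - {i}). g t (insert i Z))" for i t
  define P0 where "P0 i t = (\<Sum>Z\<in>Pow (Q - {i}). g t Z)" for i t
  define s where "s t = (\<Sum>Z\<in>Pow Q. g t Z)" for t
  let ?n = "2 ^ card Q :: real"
  have s: "P0 i t + P1 i t = s t" if "i \<in> Q" for i t
    unfolding s_def P0_def P1_def sum_Pow_remove[OF assms(1) that] by (simp add: sum.distrib)
  have P: "P0 i t \<ge> 0" "P1 i t \<ge> 0" if "i \<in> Q" "t \<in> T" for i t
    unfolding P0_def P1_def using that by (auto intro!: sum_nonneg nn)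
  have s_sum: "(\<Sum>t\<in>T. s t) = ?n"
    unfolding s_def by (subst sum.swap) (simp add: one card_Pow assms(1))
  \<comment> \<open>The correction \<open>?n / card T - s t\<close> sums to zero over
    \<open>T\<close>, so the entropy bound can be proved term by term.\<close>
  have per_t: "(\<Sum>i\<in>Q. (sqrt (P1 i t) - sqrt (P0 i t))\<^sup>2) \<le> 2 * (s t * ln (card T) + ?n / card T - s t)"
    if t: "t \<in> T" for t
  proof (cases "s t > 0")
    case False
    have "P0 i t = 0 \<and> P1 i t = 0" if "i \<in> Q" for i
      using s[OF that, of t] P[OF that t] False by linarith
    moreover have "s t = 0"
      using False nn[OF t] by (auto simp: s_def not_less intro!: antisym sum_nonneg)
    ultimately show ?thesis by simp
  next
    case True
    have "(sqrt (P1 i t) - sqrt (P0 i t))\<^sup>2 \<le> (P1 i t - P0 i t)\<^sup>2 / s t" if i: "i \<in> Q" for i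
    proof -
      let ?x = "sqrt (P1 i t)" and ?y = "sqrt (P0 i t)"
      have xy: "?x\<^sup>2 = P1 i t" "?y\<^sup>2 = P0 i t" "?x \<ge> 0" "?y \<ge> 0"
        using P[OF i t] by auto
      \<comment> \<open>Trades the difference of square roots for the difference that the level-1
        inequality controls.\<close>
      have "(?x - ?y)\<^sup>2 * (?x\<^sup>2 + ?y\<^sup>2) \<le> (?x - ?y)\<^sup>2 * (?x + ?y)\<^sup>2"
        using xy(3,4) by (intro mult_left_mono) (auto simp: power2_sum)
      also have "\<dots> = (?x\<^sup>2 - ?y\<^sup>2)\<^sup>2"
        by (simp add: power2_eq_square algebra_simps)
      finally show ?thesis
        using s[OF i, of t] True by (simp add: xy(1,2) pos_le_divide_eq add.commute)
    qed
    then have "(\<Sum>i\<in>Q. (sqrt (P1 i t) - sqrt (P0 i t))\<^sup>2) \<le> (\<Sum>i\<in>Q. (P1 i t - P0 i t)\<^sup>2) / s t"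
      unfolding sum_divide_distrib by (rule sum_mono)
    also have "\<dots> \<le> (2 * (s t)\<^sup>2 * ln (?n / s t)) / s t"
    proof (intro divide_right_mono level_one_inequality[where g = "g t"])
      show "g t Z \<le> 1" if "Z \<subseteq> Q" for Z
        using one[OF that] member_le_sum[OF t, of "\<lambda>t. g t Z"] nn that assms(2) by auto
      show "P1 i t - P0 i t = (\<Sum>Z\<in>Pow (Q - {i}). g t (insert i Z) - g t Z)" if "i \<in> Q" for i
        by (simp add: P1_def P0_def sum_subtractf)
    qed (use assms True nn t in \<open>auto simp: s_def\<close>)
    also have "\<dots> = 2 * (s t * ln (?n / s t))"
      using True by (simp add: power2_eq_square)
    \<comment> \<open>Split at the mean \<open>?n / card T\<close> of \<open>s\<close>; the second
      logarithm is then bounded by \<open>ln u \<le> u - 1\<close>.\<close>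
    also have "ln (?n / s t) = ln (card T) + ln (?n / (card T * s t))"
      using True assms by (subst ln_mult_pos [symmetric]) (auto simp: card_gt_0_iff)
    also have "\<dots> \<le> ln (card T) + (?n / (card T * s t) - 1)"
      using True assms by (intro add_mono ln_le_minus_one order.refl) (auto simp: card_gt_0_iff)
    finally show ?thesis
      using True by (simp add: algebra_simps)
  qed
  have "(\<Sum>i\<in>Q. \<Sum>t\<in>T. (sqrt (P1 i t) - sqrt (P0 i t))\<^sup>2)
      \<le> (\<Sum>t\<in>T. 2 * (s t * ln (card T) + ?n / card T - s t))"
    by (subst sum.swap) (intro sum_mono per_t)
  also have "\<dots> = 2 * ((\<Sum>t\<in>T. s t) * ln (card T) + (card T * (?n / card T) - (\<Sum>t\<in>T. s t)))"
    by (simp add: sum.distrib sum_subtractf sum_distrib_left sum_distrib_right)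
  also have "\<dots> = 2 * ?n * ln (card T)"
    using assms by (simp add: s_sum)
  finally show ?thesis unfolding P1_def P0_def .
qed

section \<open>Searching for the unique common element of two sets\<close>

lemma sum_Pow_Int_Diff:
  fixes \<phi> \<psi> :: "'a set \<Rightarrow> real"
  assumes "finite Q" "R \<subseteq> Q"
  shows "(\<Sum>Z\<in>Pow Q. \<phi> (Z \<inter> R) * \<psi> (Z - R)) = (\<Sum>Z\<in>Pow R. \<phi> Z) * (\<Sum>Z\<in>Pow (Q - R). \<psi> Z)"
proof -
  have "(\<Sum>Z\<in>Pow R. \<phi> Z) * (\<Sum>Z\<in>Pow (Q - R). \<psi> Z) = (\<Sum>(V, W)\<in>Pow R \<times> Pow (Q - R). \<phi> V * \<psi> W)"
    by (simp add: sum_product sum.cartesian_product)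
  also have "\<dots> = (\<Sum>Z\<in>Pow Q. \<phi> (Z \<inter> R) * \<psi> (Z - R))"
    by (rule sum.reindex_bij_witness[where i = "\<lambda>Z. (Z \<inter> R, Z - R)" and j = "\<lambda>(V, W). V \<union> W"])
      (use assms in \<open>auto intro!: arg_cong2[where f = "(*)"] arg_cong[where f = \<phi>] arg_cong[where f = \<psi>]\<close>)
  finally show ?thesis by simp
qed

text \<open>
  The elements of \<open>R\<close> other than \<open>i\<close> may only lie in the first set, those outside \<open>R\<close> only in the
  second, and \<open>Z\<close> tells which of them do.
\<close>

lemma unique_intersection_search:
  fixes a b :: "'t \<Rightarrow> 'a set \<Rightarrow> real" and w :: "'a \<Rightarrow> 't \<Rightarrow> real"
  assumes fin: "finite Q" "finite T" "T \<noteq> {}"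
    and a: "\<And>t X. t \<in> T \<Longrightarrow> X \<subseteq> Q \<Longrightarrow> 0 \<le> a t X"
    and b: "\<And>t Y. t \<in> T \<Longrightarrow> Y \<subseteq> Q \<Longrightarrow> 0 \<le> b t Y"
    and one: "\<And>X Y. X \<subseteq> Q \<Longrightarrow> Y \<subseteq> Q \<Longrightarrow> (\<Sum>t\<in>T. a t X * b t Y) = 1"
    and w: "\<And>i t. i \<in> Q \<Longrightarrow> t \<in> T \<Longrightarrow> 0 \<le> w i t"
      "\<And>t. t \<in> T \<Longrightarrow> (\<Sum>i\<in>Q. w i t) \<le> 1"
  shows "(\<Sum>i\<in>Q. \<Sum>R\<in>Pow (Q - {i}). \<Sum>Z\<in>Pow (Q - {i}). \<Sum>t\<in>T.
            w i t * (a t (insert i (Z \<inter> R)) * b t (insert i (Z - R))))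
         \<le> (2 ^ (card Q - 1))\<^sup>2 * (8 + 32 * ln (card T))" (is "?L \<le> _")
proof -
  have ab: "0 \<le> a t X * b t Y" if "t \<in> T" "X \<subseteq> Q" "Y \<subseteq> Q" for t X Y
    using a b that by simp
  have w1: "w i t \<le> 1" if "i \<in> Q" "t \<in> T" for i t
    using w(2)[OF that(2)] member_le_sum[OF that(1), of "\<lambda>i. w i t"] w(1) that fin by force
  \<comment> \<open>\<open>D\<close> is the territory of the first set, so a single uniform
    \<open>Z\<close> encodes a disjoint pair.\<close>
  define g where "g D t Z = a t (Z \<inter> D) * b t (Z - D)" for D t Z
  define Hel where "Hel i D = (\<Sum>t\<in>T. (sqrt (\<Sum>Z\<in>Pow (Q - {i}). g D t (insert i Z))
            - sqrt (\<Sum>Z\<in>Pow (Q - {i}). g D t Z))\<^sup>2)" for i D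
  have Hel: "(\<Sum>i\<in>Q. Hel i D) \<le> 2 * 2 ^ card Q * ln (card T)" if "D \<subseteq> Q" for D
    unfolding Hel_def
    by (rule sum_hellinger_le_ln_card) (use fin that in \<open>auto simp: g_def intro!: ab one\<close>)
  define E :: real where "E = 2 ^ (card Q - 1)"
  have card_E: "real (card (Pow (Q - {i}))) = E" if "i \<in> Q" for i
    using that fin by (simp add: card_Pow E_def)
  \<comment> \<open>With \<open>i\<close> in the territory of the first set
    (\<open>insert i R\<close>), flipping \<open>i\<close> in \<open>Z\<close> changes only the
    first set; with \<open>i\<close> outside (\<open>R\<close>), only the second. Hence both
    distances in \<open>cut_and_paste\<close> are instances of \<open>Hel\<close>.\<close>
  have per: "(\<Sum>Z\<in>Pow (Q - {i}). \<Sum>t\<in>T.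
        w i t * (a t (insert i (Z \<inter> R)) * b t (insert i (Z - R))))
      \<le> 2 * (\<Sum>Z\<in>Pow (Q - {i}). \<Sum>t\<in>T. w i t * g R t Z) + 4 * (Hel i (insert i R) + Hel i R)"
    if i: "i \<in> Q" and R: "R \<in> Pow (Q - {i})" for i R
  proof -
    let ?Q = "Q - {i}"
    \<comment> \<open>For fixed \<open>R\<close> the two sets vary independently inside
      \<open>R\<close> and inside its complement, so summing over \<open>Z\<close> keeps the
      transcript weights products. Each total mass is then the number of sets
      \<open>Z\<close>.\<close>
    define \<alpha>\<^sub>0 where "\<alpha>\<^sub>0 t = (\<Sum>Z\<in>Pow R. a t Z)" for t
    define \<alpha>\<^sub>1 where "\<alpha>\<^sub>1 t = (\<Sum>Z\<in>Pow R. a t (insert i Z))" for t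
    define \<beta>\<^sub>0 where "\<beta>\<^sub>0 t = (\<Sum>Z\<in>Pow (?Q - R). b t Z)" for t
    define \<beta>\<^sub>1 where "\<beta>\<^sub>1 t = (\<Sum>Z\<in>Pow (?Q - R). b t (insert i Z))" for t
    have R': "R \<subseteq> ?Q" "finite ?Q" using R fin by auto
    note split = sum_Pow_Int_Diff[OF R'(2,1), symmetric]
    have eq: "\<alpha>\<^sub>0 t * \<beta>\<^sub>0 t = (\<Sum>Z\<in>Pow ?Q. a t (Z \<inter> R) * b t (Z - R))"
      "\<alpha>\<^sub>1 t * \<beta>\<^sub>0 t = (\<Sum>Z\<in>Pow ?Q. a t (insert i (Z \<inter> R)) * b t (Z - R))"
      "\<alpha>\<^sub>0 t * \<beta>\<^sub>1 t = (\<Sum>Z\<in>Pow ?Q. a t (Z \<inter> R) * b t (insert i (Z - R)))"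
      "\<alpha>\<^sub>1 t * \<beta>\<^sub>1 t = (\<Sum>Z\<in>Pow ?Q. a t (insert i (Z \<inter> R)) * b t (insert i (Z - R)))" for t
      unfolding \<alpha>\<^sub>0_def \<alpha>\<^sub>1_def \<beta>\<^sub>0_def \<beta>\<^sub>1_def
      by (rule split split[where \<phi> = "\<lambda>Z. a t (insert i Z)"] split[where \<psi> = "\<lambda>Z. b t (insert i Z)"]
          split[where \<phi> = "\<lambda>Z. a t (insert i Z)" and \<psi> = "\<lambda>Z. b t (insert i Z)"])+
    have sub: "Z \<inter> R \<subseteq> Q" "Z - R \<subseteq> Q" "insert i (Z \<inter> R) \<subseteq> Q" "insert i (Z - R) \<subseteq> Q"
      if "Z \<in> Pow ?Q" for Z
      using that i by auto
    have "(\<Sum>Z\<in>Pow ?Q. \<Sum>t\<in>T. w i t * (a t (insert i (Z \<inter> R)) * b t (insert i (Z - R))))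
        = (\<Sum>t\<in>T. w i t * (\<alpha>\<^sub>1 t * \<beta>\<^sub>1 t))"
      unfolding eq sum_distrib_left by (rule sum.swap)
    also have "\<dots> \<le> 2 * (\<Sum>t\<in>T. w i t * (\<alpha>\<^sub>0 t * \<beta>\<^sub>0 t))
        + 4 * ((\<Sum>t\<in>T. (sqrt (\<alpha>\<^sub>1 t * \<beta>\<^sub>0 t) - sqrt (\<alpha>\<^sub>0 t * \<beta>\<^sub>0 t))\<^sup>2)
             + (\<Sum>t\<in>T. (sqrt (\<alpha>\<^sub>0 t * \<beta>\<^sub>1 t) - sqrt (\<alpha>\<^sub>0 t * \<beta>\<^sub>0 t))\<^sup>2))"
    proof (rule cut_and_paste[where E = E])
      show "\<alpha>\<^sub>0 t \<ge> 0" "\<alpha>\<^sub>1 t \<ge> 0" "\<beta>\<^sub>0 t \<ge> 0" "\<beta>\<^sub>1 t \<ge> 0" if "t \<in> T" for t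
        unfolding \<alpha>\<^sub>0_def \<alpha>\<^sub>1_def \<beta>\<^sub>0_def \<beta>\<^sub>1_def using that i R by (auto intro!: sum_nonneg a b)
      have swap: "(\<Sum>t\<in>T. \<Sum>Z\<in>Pow ?Q. F t Z) = E" if "\<And>Z. Z \<in> Pow ?Q \<Longrightarrow> (\<Sum>t\<in>T. F t Z) = 1" for F
        using card_E[OF i] by (subst sum.swap) (simp add: that)
      show "(\<Sum>t\<in>T. \<alpha>\<^sub>0 t * \<beta>\<^sub>0 t) = E" "(\<Sum>t\<in>T. \<alpha>\<^sub>1 t * \<beta>\<^sub>0 t) = E"
        "(\<Sum>t\<in>T. \<alpha>\<^sub>0 t * \<beta>\<^sub>1 t) = E" "(\<Sum>t\<in>T. \<alpha>\<^sub>1 t * \<beta>\<^sub>1 t) = E"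
        unfolding eq by (intro swap one sub; assumption)+
    qed (use i w w1 in auto)
    also have "(\<Sum>t\<in>T. w i t * (\<alpha>\<^sub>0 t * \<beta>\<^sub>0 t)) = (\<Sum>Z\<in>Pow ?Q. \<Sum>t\<in>T. w i t * g R t Z)"
      unfolding eq g_def sum_distrib_left by (rule sum.swap)
    also have "(\<Sum>t\<in>T. (sqrt (\<alpha>\<^sub>1 t * \<beta>\<^sub>0 t) - sqrt (\<alpha>\<^sub>0 t * \<beta>\<^sub>0 t))\<^sup>2) = Hel i (insert i R)"
    proof -
      have "g (insert i R) t (insert i Z) = a t (insert i (Z \<inter> R)) * b t (Z - R)"
        "g (insert i R) t Z = a t (Z \<inter> R) * b t (Z - R)" if "Z \<in> Pow ?Q" for t Z
      proof -
        have "insert i Z \<inter> insert i R = insert i (Z \<inter> R)" "insert i Z - insert i R = Z - R"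
          "Z \<inter> insert i R = Z \<inter> R" "Z - insert i R = Z - R"
          using that by auto
        then show "g (insert i R) t (insert i Z) = a t (insert i (Z \<inter> R)) * b t (Z - R)"
          "g (insert i R) t Z = a t (Z \<inter> R) * b t (Z - R)" by (simp_all add: g_def)
      qed
      then show ?thesis unfolding Hel_def eq by simp
    qed
    also have "(\<Sum>t\<in>T. (sqrt (\<alpha>\<^sub>0 t * \<beta>\<^sub>1 t) - sqrt (\<alpha>\<^sub>0 t * \<beta>\<^sub>0 t))\<^sup>2) = Hel i R"
    proof -
      have "g R t (insert i Z) = a t (Z \<inter> R) * b t (insert i (Z - R))" if "Z \<in> Pow ?Q" for t Z
      proof -
        have "insert i Z \<inter> R = Z \<inter> R" "insert i Z - R = insert i (Z - R)"
          using that R by auto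
        then show ?thesis by (simp add: g_def)
      qed
      then show ?thesis unfolding Hel_def eq by (simp add: g_def)
    qed
    finally show ?thesis .
  qed
  have gw_nonneg: "0 \<le> w i t * g D t Z" if "i \<in> Q" "t \<in> T" "D \<subseteq> Q" "Z \<subseteq> Q" for i t D Z
    unfolding g_def using that by (intro mult_nonneg_nonneg ab w) auto
  have "?L \<le> (\<Sum>i\<in>Q. \<Sum>R\<in>Pow (Q - {i}).
      2 * (\<Sum>Z\<in>Pow (Q - {i}). \<Sum>t\<in>T. w i t * g R t Z) + 4 * (Hel i (insert i R) + Hel i R))"
    by (intro sum_mono per)
  \<comment> \<open>Every \<open>D \<subseteq> Q\<close> is exactly one of \<open>R\<close> and
    \<open>insert i R\<close> with \<open>R\<close> avoiding \<open>i\<close>, so the paired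
    distances add up to one sum over all \<open>D\<close>.\<close>
  also have "\<dots> = 2 * (\<Sum>i\<in>Q. \<Sum>R\<in>Pow (Q - {i}). \<Sum>Z\<in>Pow (Q - {i}). \<Sum>t\<in>T. w i t * g R t Z)
      + 4 * (\<Sum>i\<in>Q. \<Sum>D\<in>Pow Q. Hel i D)"
    by (simp add: sum.distrib sum_distrib_left sum_Pow_remove[OF fin(1)] add.commute)
  also have "(\<Sum>i\<in>Q. \<Sum>D\<in>Pow Q. Hel i D) \<le> (\<Sum>D\<in>Pow Q. 2 * 2 ^ card Q * ln (card T))"
    by (subst sum.swap) (intro sum_mono Hel, auto)
  also have "\<dots> = 2 * (2 ^ card Q)\<^sup>2 * ln (card T)"
    using fin by (simp add: card_Pow power2_eq_square)
  \<comment> \<open>Enlarging the ranges of \<open>R\<close> and \<open>Z\<close> removes their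
    dependence on \<open>i\<close>. The sum over \<open>i\<close> can then be taken innermost, where
    the guesses weigh at most 1.\<close>
  also have "(\<Sum>i\<in>Q. \<Sum>R\<in>Pow (Q - {i}). \<Sum>Z\<in>Pow (Q - {i}). \<Sum>t\<in>T. w i t * g R t Z)
      \<le> (\<Sum>i\<in>Q. \<Sum>D\<in>Pow Q. \<Sum>Z\<in>Pow Q. \<Sum>t\<in>T. w i t * g D t Z)"
  proof (rule sum_mono)
    fix i assume i: "i \<in> Q"
    have "(\<Sum>R\<in>Pow (Q - {i}). \<Sum>Z\<in>Pow (Q - {i}). \<Sum>t\<in>T. w i t * g R t Z)
       \<le> (\<Sum>R\<in>Pow (Q - {i}). \<Sum>Z\<in>Pow Q. \<Sum>t\<in>T. w i t * g R t Z)"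
      using fin i by (intro sum_mono sum_mono2 sum_nonneg gw_nonneg) auto
    also have "\<dots> \<le> (\<Sum>D\<in>Pow Q. \<Sum>Z\<in>Pow Q. \<Sum>t\<in>T. w i t * g D t Z)"
      using fin i by (intro sum_mono2 sum_nonneg gw_nonneg) auto
    finally show "(\<Sum>R\<in>Pow (Q - {i}). \<Sum>Z\<in>Pow (Q - {i}). \<Sum>t\<in>T. w i t * g R t Z)
       \<le> (\<Sum>D\<in>Pow Q. \<Sum>Z\<in>Pow Q. \<Sum>t\<in>T. w i t * g D t Z)" .
  qed
  also have "\<dots> = (\<Sum>D\<in>Pow Q. \<Sum>Z\<in>Pow Q. \<Sum>t\<in>T. (\<Sum>i\<in>Q. w i t) * g D t Z)"
    by (subst sum.swap, intro sum.cong refl, subst sum.swap, intro sum.cong refl, subst sum.swap,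
        simp add: sum_distrib_right)
  also have "\<dots> \<le> (\<Sum>D\<in>Pow Q. \<Sum>Z\<in>Pow Q. \<Sum>t\<in>T. 1 * g D t Z)"
    unfolding g_def by (intro sum_mono mult_right_mono w ab) auto
  also have "\<dots> = (\<Sum>D\<in>Pow Q. \<Sum>Z\<in>Pow Q. 1)"
    unfolding g_def by (intro sum.cong refl) (subst mult_1, rule one, auto)
  also have "\<dots> = (2 ^ card Q)\<^sup>2"
    using fin by (simp add: card_Pow power2_eq_square)
  finally have main: "?L \<le> 2 * (2 ^ card Q)\<^sup>2 + 4 * (2 * (2 ^ card Q)\<^sup>2 * ln (card T))"
    by simp
  \<comment> \<open>For nonempty \<open>Q\<close>, \<open>2 ^ card Q = 2 * E\<close> turns the
    factors 2 and 8 into 8 and 32. For empty \<open>Q\<close> the subtraction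
    \<open>card Q - 1\<close> is truncated.\<close>
  show ?thesis
  proof (cases "Q = {}")
    case True
    then show ?thesis using fin by (simp add: card_gt_0_iff Suc_le_eq)
  next
    case False
    then have "card Q = Suc (card Q - 1)"
      using fin by (simp add: card_gt_0_iff)
    then have "(2::real) ^ card Q = 2 * E"
      unfolding E_def by (metis power_Suc)
    then show ?thesis
      using main unfolding E_def[symmetric] by (simp add: power2_eq_square algebra_simps)
  qed
qed

section \<open>Transcripts of streaming algorithms\<close>

lemma sum_lists_Suc:
  assumes "finite B"
  shows "(\<Sum>\<tau> | set \<tau> \<subseteq> B \<and> length \<tau> = Suc r. F \<tau>)
       = (\<Sum>m\<in>B. \<Sum>\<tau> | set \<tau> \<subseteq> B \<and> length \<tau> = r. F (m # \<tau>))"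
proof -
  have "(\<Sum>m\<in>B. \<Sum>\<tau> | set \<tau> \<subseteq> B \<and> length \<tau> = r. F (m # \<tau>))
      = (\<Sum>(m, \<tau>)\<in>B \<times> {\<tau>. set \<tau> \<subseteq> B \<and> length \<tau> = r}. F (m # \<tau>))"
    by (rule sum.cartesian_product)
  also have "\<dots> = (\<Sum>\<tau> | set \<tau> \<subseteq> B \<and> length \<tau> = Suc r. F \<tau>)"
    by (rule sum.reindex_bij_witness[where i = "\<lambda>\<tau>. (hd \<tau>, tl \<tau>)" and j = "\<lambda>(m, \<tau>). m # \<tau>"])
      (auto simp: length_Suc_conv)
  finally show ?thesis by simp
qed

text \<open>The lists \<open>\<tau>\<close> are transcripts with the latest message at the head.\<close>

definition product_form ::
  "'x set \<Rightarrow> 'y set \<Rightarrow> 'm set \<Rightarrow> nat \<Rightarrow> ('x \<Rightarrow> 'y \<Rightarrow> 'm pmf) \<Rightarrow> bool" where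
  "product_form XS YS B r \<Phi> \<longleftrightarrow>
     (\<exists>a b. (\<forall>\<tau> X. 0 \<le> a \<tau> X) \<and> (\<forall>\<tau> Y. 0 \<le> b \<tau> Y) \<and>
       (\<forall>X\<in>XS. \<forall>Y\<in>YS. \<forall>m\<in>B. pmf (\<Phi> X Y) m =
          (\<Sum>\<tau> | set \<tau> \<subseteq> B \<and> length \<tau> = r. a (m # \<tau>) X * b (m # \<tau>) Y)))"

lemma product_form_swap:
  "product_form XS YS B r \<Phi> \<Longrightarrow> product_form YS XS B r (\<lambda>Y X. \<Phi> X Y)"
  unfolding product_form_def
proof (elim exE conjE)
  fix a b
  assume "\<forall>\<tau> X. 0 \<le> a \<tau> X" "\<forall>\<tau> Y. 0 \<le> b \<tau> Y"
    "\<forall>X\<in>XS. \<forall>Y\<in>YS. \<forall>m\<in>B. pmf (\<Phi> X Y) m =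
      (\<Sum>\<tau> | set \<tau> \<subseteq> B \<and> length \<tau> = r. a (m # \<tau>) X * (b (m # \<tau>) Y :: real))"
  then show "\<exists>b a. (\<forall>\<tau> Y. 0 \<le> b \<tau> Y) \<and> (\<forall>\<tau> X. 0 \<le> a \<tau> X) \<and>
    (\<forall>Y\<in>YS. \<forall>X\<in>XS. \<forall>m\<in>B. pmf (\<Phi> X Y) m =
      (\<Sum>\<tau> | set \<tau> \<subseteq> B \<and> length \<tau> = r. b (m # \<tau>) Y * (a (m # \<tau>) X :: real)))"
    by (intro exI[of _ b] exI[of _ a]) (simp add: mult.commute)
qed

text \<open>The new message is drawn knowing only the previous message and \<open>X\<close>, so its
  probability is absorbed by the \<open>X\<close>-factor and the \<open>Y\<close>-factor is
  unchanged.\<close>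

lemma product_form_bind:
  assumes "product_form XS YS B r \<Phi>" "finite B"
    and "\<And>X Y. X \<in> XS \<Longrightarrow> Y \<in> YS \<Longrightarrow> set_pmf (\<Phi> X Y) \<subseteq> B"
    and "\<And>X Y. X \<in> XS \<Longrightarrow> Y \<in> YS \<Longrightarrow> \<Phi>' X Y = bind_pmf (\<Phi> X Y) (\<kappa> X)"
  shows "product_form XS YS B (Suc r) \<Phi>'"
proof -
  obtain a b where ab: "\<And>\<tau> X. 0 \<le> a \<tau> X" "\<And>\<tau> Y. 0 \<le> b \<tau> Y"
    and eq: "\<And>X Y m. X \<in> XS \<Longrightarrow> Y \<in> YS \<Longrightarrow> m \<in> B \<Longrightarrow> pmf (\<Phi> X Y) m =
          (\<Sum>\<tau> | set \<tau> \<subseteq> B \<and> length \<tau> = r. a (m # \<tau>) X * b (m # \<tau>) Y)"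
    using assms(1) unfolding product_form_def by blast
  define a' where "a' \<tau> X = a (tl \<tau>) X * pmf (\<kappa> X (hd (tl \<tau>))) (hd \<tau>)" for \<tau> X
  define b' where "b' \<tau> Y = b (tl \<tau>) Y" for \<tau> Y
  have "pmf (\<Phi>' X Y) m' = (\<Sum>\<tau> | set \<tau> \<subseteq> B \<and> length \<tau> = Suc r. a' (m' # \<tau>) X * b' (m' # \<tau>) Y)"
    if XY: "X \<in> XS" "Y \<in> YS" and m': "m' \<in> B" for X Y m'
  proof -
    have "pmf (\<Phi>' X Y) m' = (\<Sum>m\<in>B. pmf (\<kappa> X m) m' * pmf (\<Phi> X Y) m)"
      unfolding assms(4)[OF XY] pmf_bind
      by (rule integral_measure_pmf_real) (use assms(2) assms(3)[OF XY] in auto)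
    also have "\<dots> = (\<Sum>m\<in>B. \<Sum>\<tau> | set \<tau> \<subseteq> B \<and> length \<tau> = r. a' (m' # m # \<tau>) X * b' (m' # m # \<tau>) Y)"
      by (intro sum.cong) (auto simp: eq XY a'_def b'_def sum_distrib_left ac_simps)
    finally show ?thesis
      by (simp add: sum_lists_Suc[OF assms(2)])
  qed
  moreover have "0 \<le> a' \<tau> X" "0 \<le> b' \<tau> Y" for \<tau> X Y
    by (auto simp: a'_def b'_def ab)
  ultimately show ?thesis unfolding product_form_def by blast
qed

lemma product_form_bind':
  assumes "product_form XS YS B r \<Phi>" "finite B"
    and "\<And>X Y. X \<in> XS \<Longrightarrow> Y \<in> YS \<Longrightarrow> set_pmf (\<Phi> X Y) \<subseteq> B"
    and "\<And>X Y. X \<in> XS \<Longrightarrow> Y \<in> YS \<Longrightarrow> \<Phi>' X Y = bind_pmf (\<Phi> X Y) (\<kappa> Y)"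
  shows "product_form XS YS B (Suc r) \<Phi>'"
  by (rule product_form_swap, rule product_form_bind[OF product_form_swap[OF assms(1)] assms(2)])
    (use assms in auto)

section \<open>Transcripts of scans in two halves\<close>

primrec kernel :: "machine \<Rightarrow> nat list \<Rightarrow> nat \<Rightarrow> nat \<Rightarrow> bool list \<Rightarrow> bool list pmf" where
  "kernel M \<sigma> t 0 m = return_pmf m"
| "kernel M \<sigma> t (Suc l) m = kernel M \<sigma> t l m \<bind> step M (t + l) (\<sigma> ! ((t + l) mod length \<sigma>))"

lemma memory_add: "memory M \<sigma> (t + l) = memory M \<sigma> t \<bind> kernel M \<sigma> t l"
  by (induction l) (simp_all add: bind_return_pmf' bind_assoc_pmf)

lemma kernel_cong:
  assumes "length \<sigma> = length \<sigma>'"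
    and "\<And>u. t \<le> u \<Longrightarrow> u < t + l \<Longrightarrow> \<sigma> ! (u mod length \<sigma>) = \<sigma>' ! (u mod length \<sigma>)"
  shows "kernel M \<sigma> t l m = kernel M \<sigma>' t l m"
  using assms(2) by (induction l) (simp_all add: assms(1))

text \<open>A pass first scans the positions below \<open>h\<close>, which depend on
  \<open>X\<close> only, and then the others, which depend on \<open>Y\<close> only. Each half adds
  one message, hence \<open>2 * r\<close>.\<close>

lemma memory_product_form:
  fixes \<sigma> :: "'x \<Rightarrow> 'y \<Rightarrow> nat list"
  assumes "finite B" "h \<le> n" and len: "\<And>X Y. length (\<sigma> X Y) = n"
    and left: "\<And>X Y Y' j. j < h \<Longrightarrow> \<sigma> X Y ! j = \<sigma> X Y' ! j"
    and right: "\<And>X X' Y j. h \<le> j \<Longrightarrow> j < n \<Longrightarrow> \<sigma> X Y ! j = \<sigma> X' Y ! j"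
    and supp: "\<And>X Y t. X \<in> XS \<Longrightarrow> Y \<in> YS \<Longrightarrow> t \<le> P * n \<Longrightarrow> set_pmf (memory M (\<sigma> X Y) t) \<subseteq> B"
    and "r \<le> P"
  shows "product_form XS YS B (2 * r) (\<lambda>X Y. memory M (\<sigma> X Y) (r * n))"
  using assms(7)
proof (induction r)
  case 0
  \<comment> \<open>The start memory depends on neither input; its probability is charged to the
    first factor.\<close>
  have "\<exists>a b. (\<forall>\<tau> X. 0 \<le> a \<tau> X) \<and> (\<forall>\<tau> Y. 0 \<le> b \<tau> Y) \<and>
       (\<forall>X\<in>XS. \<forall>Y\<in>YS. \<forall>m\<in>B. pmf (start M) m = a [m] X * (b [m] Y :: real))"
    by (rule exI[of _ "\<lambda>\<tau> X. pmf (start M) (hd \<tau>)"], rule exI[of _ "\<lambda>\<tau> Y. 1"]) auto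
  then show ?case
    by (simp add: product_form_def conj_commute cong: conj_cong)
next
  case (Suc r)
  have "r * n + n \<le> P * n"
    using Suc.prems mult_le_mono1[of "Suc r" P n] by simp
  then have le: "r * n \<le> P * n" "r * n + h \<le> P * n"
    using assms(2) by linarith+
  have pos: "r * n + u < r * n + n \<Longrightarrow> (r * n + u) mod n = u" for u by simp
  have mid: "product_form XS YS B (Suc (2 * r)) (\<lambda>X Y. memory M (\<sigma> X Y) (r * n + h))"
  proof (rule product_form_bind)
    fix X Y
    \<comment> \<open>An arbitrary second argument exhibits the kernel as a function of
      \<open>X\<close> alone.\<close>
    have "kernel M (\<sigma> X Y) (r * n) h = kernel M (\<sigma> X undefined) (r * n) h"
    proof (intro ext kernel_cong)
      fix u assume "r * n \<le> u" "u < r * n + h"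
      then obtain v where "u = r * n + v" "v < h"
        by (metis le_Suc_ex nat_add_left_cancel_less)
      then show "\<sigma> X Y ! (u mod length (\<sigma> X Y)) = \<sigma> X undefined ! (u mod length (\<sigma> X Y))"
        using assms(2) by (simp add: len left)
    qed (simp add: len)
    then show "memory M (\<sigma> X Y) (r * n + h) = memory M (\<sigma> X Y) (r * n) \<bind> kernel M (\<sigma> X undefined) (r * n) h"
      by (simp add: memory_add)
  qed (use Suc assms(1) le supp in auto)
  have "product_form XS YS B (Suc (Suc (2 * r))) (\<lambda>X Y. memory M (\<sigma> X Y) (r * n + h + (n - h)))"
  proof (rule product_form_bind'[OF mid])
    fix X Y
    have "kernel M (\<sigma> X Y) (r * n + h) (n - h) = kernel M (\<sigma> undefined Y) (r * n + h) (n - h)"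
    proof (intro ext kernel_cong)
      fix u assume "r * n + h \<le> u" "u < r * n + h + (n - h)"
      then obtain v where "u = r * n + (h + v)" "h + v < n"
        using assms(2) by (metis add.assoc le_Suc_ex nat_add_left_cancel_less le_add_diff_inverse)
      then show "\<sigma> X Y ! (u mod length (\<sigma> X Y)) = \<sigma> undefined Y ! (u mod length (\<sigma> X Y))"
        using right[of "h + v" X Y undefined] by (simp add: len)
    qed (simp add: len)
    then show "memory M (\<sigma> X Y) (r * n + h + (n - h))
      = memory M (\<sigma> X Y) (r * n + h) \<bind> kernel M (\<sigma> undefined Y) (r * n + h) (n - h)"
      by (simp add: memory_add)
  qed (use assms(1) le supp in auto)
  moreover have "r * n + h + (n - h) = Suc r * n" using assms(2) by simp
  ultimately show ?case by simp
qed

section \<open>From transcripts to samplers\<close>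

lemma machine_search:
  fixes \<sigma> :: "'i set \<Rightarrow> 'i set \<Rightarrow> nat list" and gad :: "(nat \<times> nat) option \<Rightarrow> 'i option"
  assumes "finite Q" "finite B" "h \<le> n" and len: "\<And>X Y. length (\<sigma> X Y) = n"
    and left: "\<And>X Y Y' j. j < h \<Longrightarrow> \<sigma> X Y ! j = \<sigma> X Y' ! j"
    and right: "\<And>X X' Y j. h \<le> j \<Longrightarrow> j < n \<Longrightarrow> \<sigma> X Y ! j = \<sigma> X' Y ! j"
    and supp: "\<And>X Y t. X \<subseteq> Q \<Longrightarrow> Y \<subseteq> Q \<Longrightarrow> t \<le> passes M * n \<Longrightarrow> set_pmf (memory M (\<sigma> X Y) t) \<subseteq> B"
  shows "(\<Sum>i\<in>Q. \<Sum>R\<in>Pow (Q - {i}). \<Sum>Z\<in>Pow (Q - {i}).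
            pmf (map_pmf gad (run M (\<sigma> (insert i (Z \<inter> R)) (insert i (Z - R))))) (Some i))
         \<le> (2 ^ (card Q - 1))\<^sup>2 * (8 + 32 * ((2 * real (passes M) + 1) * ln (real (card B))))"
proof -
  let ?P = "passes M"
  \<comment> \<open>Two messages per pass, and the start memory is one more; the head is the final
    memory.\<close>
  define T where "T = {\<tau>. set \<tau> \<subseteq> B \<and> length \<tau> = Suc (2 * ?P)}"
  have "product_form (Pow Q) (Pow Q) B (2 * ?P) (\<lambda>X Y. memory M (\<sigma> X Y) (?P * n))"
    by (rule memory_product_form[where h = h and P = ?P]) (use assms in auto)
  then obtain a b where ab: "\<And>\<tau> X. 0 \<le> a \<tau> X" "\<And>\<tau> Y. 0 \<le> b \<tau> Y"
    and eq: "\<And>X Y m. X \<subseteq> Q \<Longrightarrow> Y \<subseteq> Q \<Longrightarrow> m \<in> B \<Longrightarrow> pmf (memory M (\<sigma> X Y) (?P * n)) m =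
          (\<Sum>\<tau> | set \<tau> \<subseteq> B \<and> length \<tau> = 2 * ?P. a (m # \<tau>) X * b (m # \<tau>) Y)"
    unfolding product_form_def by blast
  \<comment> \<open>The output is drawn from the final memory alone, hence is a randomized guess
    attached to the transcript.\<close>
  define w where "w i \<tau> = pmf (map_pmf gad (out M (hd \<tau>))) (Some i)" for i \<tau>
  have "B \<noteq> {}"
    using supp[of "{}" "{}" 0] set_pmf_not_empty[of "start M"] by auto
  then obtain m where "m \<in> B" by blast
  then have "replicate (Suc (2 * ?P)) m \<in> T"
    by (auto simp: T_def)
  then have T: "T \<noteq> {}" "finite T" "card T = card B ^ Suc (2 * ?P)"
    using assms(2) by (blast, simp_all add: T_def finite_lists_length_eq card_lists_length_eq)
  have one: "(\<Sum>\<tau>\<in>T. a \<tau> X * b \<tau> Y) = 1" if "X \<subseteq> Q" "Y \<subseteq> Q" for X Y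
  proof -
    have "(\<Sum>\<tau>\<in>T. a \<tau> X * b \<tau> Y) = (\<Sum>m\<in>B. pmf (memory M (\<sigma> X Y) (?P * n)) m)"
      unfolding T_def sum_lists_Suc[OF assms(2)] by (intro sum.cong refl) (simp add: eq that)
    also have "\<dots> = 1"
      by (rule sum_pmf_eq_1) (use assms(2) supp[OF that] in auto)
    finally show ?thesis .
  qed
  have run: "pmf (map_pmf gad (run M (\<sigma> X Y))) (Some i) = (\<Sum>\<tau>\<in>T. w i \<tau> * (a \<tau> X * b \<tau> Y))"
    if "X \<subseteq> Q" "Y \<subseteq> Q" for X Y i
  proof -
    have "pmf (map_pmf gad (run M (\<sigma> X Y))) (Some i)
        = (\<integral>m. pmf (map_pmf gad (out M m)) (Some i) \<partial>memory M (\<sigma> X Y) (?P * n))"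
      by (simp add: run_def len map_bind_pmf pmf_bind)
    also have "\<dots> = (\<Sum>m\<in>B. pmf (map_pmf gad (out M m)) (Some i) * pmf (memory M (\<sigma> X Y) (?P * n)) m)"
      by (rule integral_measure_pmf_real) (use assms(2) supp[OF that] in auto)
    also have "\<dots> = (\<Sum>\<tau>\<in>T. w i \<tau> * (a \<tau> X * b \<tau> Y))"
      unfolding T_def sum_lists_Suc[OF assms(2)]
      by (intro sum.cong refl) (simp add: eq that w_def sum_distrib_left)
    finally show ?thesis .
  qed
  have w_sum: "(\<Sum>i\<in>Q. w i \<tau>) \<le> 1" for \<tau>
  proof -
    have "(\<Sum>i\<in>Q. w i \<tau>) = (\<Sum>z\<in>Some ` Q. pmf (map_pmf gad (out M (hd \<tau>))) z)"
      by (simp add: w_def sum.reindex)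
    also have "\<dots> = measure (map_pmf gad (out M (hd \<tau>))) (Some ` Q)"
      by (rule measure_measure_pmf_finite[symmetric]) (use assms(1) in auto)
    finally show ?thesis by simp
  qed
  have "(\<Sum>i\<in>Q. \<Sum>R\<in>Pow (Q - {i}). \<Sum>Z\<in>Pow (Q - {i}).
            pmf (map_pmf gad (run M (\<sigma> (insert i (Z \<inter> R)) (insert i (Z - R))))) (Some i))
      = (\<Sum>i\<in>Q. \<Sum>R\<in>Pow (Q - {i}). \<Sum>Z\<in>Pow (Q - {i}). \<Sum>\<tau>\<in>T.
            w i \<tau> * (a \<tau> (insert i (Z \<inter> R)) * b \<tau> (insert i (Z - R))))"
    by (intro sum.cong refl run) auto
  also have "\<dots> \<le> (2 ^ (card Q - 1))\<^sup>2 * (8 + 32 * ln (card T))"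
    by (rule unique_intersection_search) (use assms(1) T ab one w_sum in \<open>auto simp: w_def\<close>)
  also have "ln (card T) = (2 * real ?P + 1) * ln (real (card B))"
    unfolding T(3) of_nat_power
    using assms(2) \<open>B \<noteq> {}\<close> by (subst ln_realpow) (auto simp: card_gt_0_iff algebra_simps)
  finally show ?thesis .
qed

text \<open>The success probability is an average over the shared coins, and
  \<open>machine_search\<close> bounds every machine in the support, so the bound survives
  averaging.\<close>

lemma algorithm_search:
  fixes \<sigma> :: "'i set \<Rightarrow> 'i set \<Rightarrow> nat list" and gad :: "(nat \<times> nat) option \<Rightarrow> 'i option"
    and \<theta> :: real
  assumes "finite Q" "finite B" "B \<noteq> {}" "h \<le> n" "\<And>X Y. length (\<sigma> X Y) = n"
    "\<And>X Y Y' j. j < h \<Longrightarrow> \<sigma> X Y ! j = \<sigma> X Y' ! j"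
    "\<And>X X' Y j. h \<le> j \<Longrightarrow> j < n \<Longrightarrow> \<sigma> X Y ! j = \<sigma> X' Y ! j"
    and passes: "\<And>M. M \<in> set_pmf (A U f) \<Longrightarrow> passes M \<le> k"
    and supp: "\<And>M X Y t. M \<in> set_pmf (A U f) \<Longrightarrow> X \<subseteq> Q \<Longrightarrow> Y \<subseteq> Q \<Longrightarrow> t \<le> passes M * n
      \<Longrightarrow> set_pmf (memory M (\<sigma> X Y) t) \<subseteq> B"
    and success: "\<And>X Y i. X \<subseteq> Q \<Longrightarrow> Y \<subseteq> Q \<Longrightarrow> X \<inter> Y = {i}
      \<Longrightarrow> \<theta> \<le> pmf (map_pmf gad (result A U f (\<sigma> X Y))) (Some i)"
  shows "real (card Q) * \<theta> \<le> 8 + 32 * ((2 * real k + 1) * ln (real (card B)))"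
proof (cases "Q = {}")
  case True
  then show ?thesis
    using assms(2,3) by (simp add: card_gt_0_iff Suc_le_eq)
next
  case False
  let ?E = "2 ^ (card Q - 1) :: real"
  let ?X = "\<lambda>i R Z. insert i (Z \<inter> R)" and ?Y = "\<lambda>i R Z. insert i (Z - R)"
  define S where "S M i R Z = pmf (map_pmf gad (run M (\<sigma> (?X i R Z) (?Y i R Z)))) (Some i)" for M i R Z
  have int: "integrable (measure_pmf (A U f)) (\<lambda>M. S M i R Z)" for i R Z
    by (rule measure_pmf.integrable_const_bound[where B = 1]) (auto simp: S_def pmf_le_1)
  have "?E\<^sup>2 * (real (card Q) * \<theta>) = (\<Sum>i\<in>Q. \<Sum>R\<in>Pow (Q - {i}). \<Sum>Z\<in>Pow (Q - {i}). \<theta>)"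
    using assms(1) by (simp add: card_Pow power2_eq_square)
  also have "\<dots> \<le> (\<Sum>i\<in>Q. \<Sum>R\<in>Pow (Q - {i}). \<Sum>Z\<in>Pow (Q - {i}). \<integral>M. S M i R Z \<partial>A U f)"
  proof (intro sum_mono)
    fix i R Z assume "i \<in> Q" "R \<in> Pow (Q - {i})" "Z \<in> Pow (Q - {i})"
    then have "\<theta> \<le> pmf (map_pmf gad (result A U f (\<sigma> (?X i R Z) (?Y i R Z)))) (Some i)"
      by (intro success) auto
    then show "\<theta> \<le> (\<integral>M. S M i R Z \<partial>A U f)"
      by (simp add: result_def map_bind_pmf pmf_bind S_def)
  qed
  also have "\<dots> = (\<integral>M. (\<Sum>i\<in>Q. \<Sum>R\<in>Pow (Q - {i}). \<Sum>Z\<in>Pow (Q - {i}). S M i R Z) \<partial>A U f)"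
    using int by simp
  also have "\<dots> \<le> (\<integral>M. ?E\<^sup>2 * (8 + 32 * ((2 * real k + 1) * ln (real (card B)))) \<partial>A U f)"
  proof (rule integral_mono_AE)
    show "AE M in A U f. (\<Sum>i\<in>Q. \<Sum>R\<in>Pow (Q - {i}). \<Sum>Z\<in>Pow (Q - {i}). S M i R Z)
      \<le> ?E\<^sup>2 * (8 + 32 * ((2 * real k + 1) * ln (real (card B))))"
      unfolding AE_measure_pmf_iff
    proof
      fix M assume M: "M \<in> set_pmf (A U f)"
      have "(\<Sum>i\<in>Q. \<Sum>R\<in>Pow (Q - {i}). \<Sum>Z\<in>Pow (Q - {i}). S M i R Z)
          \<le> ?E\<^sup>2 * (8 + 32 * ((2 * real (passes M) + 1) * ln (real (card B))))"
        unfolding S_def using assms(1,2,4-7) supp[OF M] by (rule machine_search)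
      also have "\<dots> \<le> ?E\<^sup>2 * (8 + 32 * ((2 * real k + 1) * ln (real (card B))))"
        using assms(2,3) passes[OF M]
        by (intro mult_left_mono add_left_mono mult_right_mono) (auto simp: card_gt_0_iff Suc_le_eq)
      finally show "(\<Sum>i\<in>Q. \<Sum>R\<in>Pow (Q - {i}). \<Sum>Z\<in>Pow (Q - {i}). S M i R Z)
          \<le> ?E\<^sup>2 * (8 + 32 * ((2 * real k + 1) * ln (real (card B))))" .
    qed
  qed (use int in auto)
  also have "\<dots> = ?E\<^sup>2 * (8 + 32 * ((2 * real k + 1) * ln (real (card B))))"
    by simp
  finally show ?thesis by simp
qed

text \<open>The constant is \<open>1 / 2 * 0.1 * 0.51\<close>: the share of \<open>S\<close> in the
  moment, a lower bound for \<open>1 - \<epsilon>\<close>, and one for the probability of not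
  failing.\<close>

lemma sampler_hits:
  assumes samp: "sampler n p \<epsilon> 0.49 A" "\<epsilon> < 0.9" and U: "similarity U f" "\<sigma> \<in> streams_of U n"
    and S: "S \<subseteq> {..<n}" "moment f p \<sigma> \<le> 2 * (\<Sum>j\<in>S. degree f \<sigma> j powr p)" "moment f p \<sigma> > 0"
    and gad: "\<And>j v. j \<in> S \<Longrightarrow> gad (Some (j, v)) = z"
  shows "51 / 2000 \<le> pmf (map_pmf gad (result A U f \<sigma>)) z"
proof -
  let ?D = "result A U f \<sigma>"
  define q where "q j = degree f \<sigma> j powr p / moment f p \<sigma>" for j
  have none: "pmf ?D None \<le> 0.49"
    and lower: "\<And>j. j < n \<Longrightarrow> (1 - \<epsilon>) * q j \<le> \<P>(z in measure_pmf ?D. z = Some (j, \<sigma> ! j) \<bar> z \<noteq> None)"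
    using samp(1) U unfolding sampler_def q_def Let_def by blast+
  have q: "q j \<ge> 0" for j using S(3) by (simp add: q_def)
  have nf: "measure (measure_pmf ?D) {z. z \<noteq> None} \<ge> 0.51"
  proof -
    have "measure (measure_pmf ?D) {z. z \<noteq> None} = 1 - pmf ?D None"
      using measure_pmf.prob_compl[of "{None}" ?D] by (simp add: measure_pmf_single Compl_eq_Diff_UNIV[symmetric] Compl_eq)
    then show ?thesis using none by simp
  qed
  have point: "51 / 1000 * q j \<le> pmf ?D (Some (j, \<sigma> ! j))" if "j \<in> S" for j
  proof -
    have "{z. z = Some (j, \<sigma> ! j) \<and> z \<noteq> None} = {Some (j, \<sigma> ! j)}" by auto
    then have "pmf ?D (Some (j, \<sigma> ! j)) = \<P>(z in measure_pmf ?D. z = Some (j, \<sigma> ! j) \<bar> z \<noteq> None)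
        * measure (measure_pmf ?D) {z. z \<noteq> None}"
      using nf by (simp add: cond_prob_def measure_pmf_single)
    moreover have "(1 / 10 * q j) * (51 / 100) \<le> \<dots>"
    proof (rule mult_mono)
      have "1 / 10 * q j \<le> (1 - \<epsilon>) * q j"
        using samp(2) q by (intro mult_right_mono) auto
      then show "1 / 10 * q j \<le> \<P>(z in measure_pmf ?D. z = Some (j, \<sigma> ! j) \<bar> z \<noteq> None)"
        using lower[of j] S(1) that by force
    qed (use nf in \<open>auto simp: cond_prob_def\<close>)
    ultimately show ?thesis by simp
  qed
  have fin: "finite S" using S(1) finite_subset by blast
  have "1 / 2 \<le> (\<Sum>j\<in>S. q j)"
    using S(2,3) by (simp add: q_def sum_divide_distrib[symmetric] field_simps)
  then have "51 / 2000 \<le> 51 / 1000 * (\<Sum>j\<in>S. q j)" by simp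
  also have "\<dots> \<le> (\<Sum>j\<in>S. pmf ?D (Some (j, \<sigma> ! j)))"
    unfolding sum_distrib_left by (intro sum_mono point)
  also have "\<dots> = measure (measure_pmf ?D) ((\<lambda>j. Some (j, \<sigma> ! j)) ` S)"
    using fin by (subst measure_measure_pmf_finite) (auto simp: sum.reindex inj_on_def)
  also have "\<dots> \<le> measure (measure_pmf ?D) (gad -` {z})"
    by (rule measure_pmf.finite_measure_mono) (auto simp: gad)
  also have "\<dots> = pmf (map_pmf gad ?D) z"
    by (simp add: pmf_map)
  finally show ?thesis .
qed

section \<open>Streams encoding two sets\<close>

text \<open>Algorithms know the similarity function, so it must not reveal \<open>X\<close> or
  \<open>Y\<close>: it links all partner blocks, and the inputs only decide which items
  occur.\<close>

definition block_similarity :: "nat \<Rightarrow> nat \<Rightarrow> nat \<Rightarrow> nat \<Rightarrow> real" where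
  "block_similarity m N x y = of_bool (x = y \<or>
     (x < 2 * m * N \<and> y < 2 * m * N \<and> (x div m = y div m + N \<or> y div m = x div m + N)))"

text \<open>
  The item at position \<open>j\<close> is \<open>j\<close> if the block of \<open>j\<close> is switched on, and otherwise \<open>n + j\<close>, which is
  similar to itself only.
\<close>

definition block_stream :: "nat \<Rightarrow> nat \<Rightarrow> nat \<Rightarrow> nat set \<Rightarrow> nat set \<Rightarrow> nat list" where
  "block_stream n m N X Y = map (\<lambda>j.
     if (if j < m * N then j div m \<in> X else j < 2 * m * N \<and> j div m - N \<in> Y) then j else n + j) [0..<n]"

lemma similarity_block: "similarity U (block_similarity m N)"
  by (auto simp: similarity_def block_similarity_def)

lemma length_block_stream [simp]: "length (block_stream n m N X Y) = n"
  by (simp add: block_stream_def)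

lemma nth_block_stream: "j < n \<Longrightarrow> block_stream n m N X Y ! j =
     (if (if j < m * N then j div m \<in> X else j < 2 * m * N \<and> j div m - N \<in> Y) then j else n + j)"
  by (simp add: block_stream_def)

lemma block_stream_in_streams: "block_stream n m N X Y \<in> streams_of {..<2 * n} n"
  by (auto simp: streams_of_def block_stream_def)

lemma card_block:
  assumes "m > 0" "(c + 1) * m \<le> n"
  shows "card {l. l < n \<and> l div m = c} = m"
proof -
  have "l < n \<and> l div m = c \<longleftrightarrow> l \<in> {c * m..<(c + 1) * m}" for l
  proof -
    have "l div m = c \<longleftrightarrow> c \<le> l div m \<and> l div m < c + 1" by linarith
    also have "\<dots> \<longleftrightarrow> c * m \<le> l \<and> l < (c + 1) * m"
      by (simp only: less_eq_div_iff_mult_less_eq[OF assms(1)] div_less_iff_less_mult[OF assms(1)])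
    finally show ?thesis using assms(2) unfolding atLeastLessThan_iff by linarith
  qed
  then have "{l. l < n \<and> l div m = c} = {c * m..<(c + 1) * m}"
    by blast
  then show ?thesis by simp
qed

context
  fixes n m N i :: nat and X Y :: "nat set"
  assumes m: "m > 0" and N: "2 * m * N \<le> n"
    and XY: "X \<subseteq> {..<N}" "Y \<subseteq> {..<N}" "X \<inter> Y = {i}"
begin

lemma intersection_less: "i < N" using XY by auto

text \<open>An edge needs both partner blocks switched on, which happens for \<open>i\<close> only.
  The form as a sum of products lets the degree sum split.\<close>

lemma block_similarity_stream:
  assumes "j < n" "l < n"
  shows "block_similarity m N (block_stream n m N X Y ! j) (block_stream n m N X Y ! l) =
    of_bool (l = j) + of_bool (j div m = i) * of_bool (l div m = i + N)
      + of_bool (j div m = i + N) * of_bool (l div m = i)"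
proof -
  have low: "x < m * N \<longleftrightarrow> x div m < N" and high: "x < 2 * m * N \<longleftrightarrow> x div m < 2 * N" for x
    using m by (simp_all add: div_less_iff_less_mult mult.commute mult.left_commute)
  \<comment> \<open>Items of switched-off blocks lie beyond the range in which
    \<open>block_similarity\<close> has edges.\<close>
  have "n + j \<ge> 2 * m * N" "n + l \<ge> 2 * m * N" using N by linarith+
  then have nlow: "\<not> (n + j) div m < 2 * N" "\<not> (n + l) div m < 2 * N"
    unfolding high[symmetric] by linarith+
  define act where "act u \<longleftrightarrow> (if u < N then u \<in> X else u < 2 * N \<and> u - N \<in> Y)" for u
  \<comment> \<open>If \<open>v < N\<close>, then \<open>v\<close> lies in both sets, so
    \<open>v = i\<close>; otherwise \<open>u \<ge> 2 * N\<close> is not active.\<close>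
  have edge: "act u \<and> act v \<and> u = v + N \<longleftrightarrow> u = i + N \<and> v = i" for u v
    using XY intersection_less unfolding act_def by auto
  have act_less: "act u \<Longrightarrow> u < 2 * N" for u
    using intersection_less by (auto simp: act_def split: if_splits)
  have nth: "block_stream n m N X Y ! x = (if act (x div m) then x else n + x)" if "x < n" for x
    unfolding act_def low[symmetric] high[symmetric] by (rule nth_block_stream[OF that])
  have eq: "(if act (j div m) then j else n + j) = (if act (l div m) then l else n + l) \<longleftrightarrow> l = j"
    using assms by auto
  have lt: "(if act (j div m) then j else n + j) div m < 2 * N \<longleftrightarrow> act (j div m)"
    "(if act (l div m) then l else n + l) div m < 2 * N \<longleftrightarrow> act (l div m)"
    using nlow act_less by (cases "act (j div m)"; cases "act (l div m)"; simp)+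
  have "block_similarity m N (block_stream n m N X Y ! j) (block_stream n m N X Y ! l) =
    of_bool (l = j \<or> act (j div m) \<and> act (l div m) \<and> j div m = l div m + N
      \<or> act (l div m) \<and> act (j div m) \<and> l div m = j div m + N)"
    unfolding block_similarity_def nth[OF assms(1)] nth[OF assms(2)] high eq lt
    by (rule arg_cong[where f = of_bool]) (cases "act (j div m)"; cases "act (l div m)"; simp)
  also have "\<dots> = of_bool (l = j \<or> j div m = i + N \<and> l div m = i \<or> l div m = i + N \<and> j div m = i)"
    by (simp only: edge)
  also have "\<dots> = of_bool (l = j) + of_bool (j div m = i) * of_bool (l div m = i + N)
      + of_bool (j div m = i + N) * of_bool (l div m = i)"
    using intersection_less by (auto simp: of_bool_def)
  finally show ?thesis .
qed

lemma degree_block: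
  assumes "j < n"
  shows "degree (block_similarity m N) (block_stream n m N X Y) j
    = (if j div m = i \<or> j div m = i + N then 1 + real m else 1)"
proof -
  have "(i + 1) * m \<le> n" "(i + N + 1) * m \<le> n"
    using mult_le_mono1[of "i + 1" "2 * N" m] mult_le_mono1[of "i + N + 1" "2 * N" m] intersection_less N
    by (auto simp: mult_ac)
  then have card: "card ({..<n} \<inter> {l. l div m = i}) = m" "card ({..<n} \<inter> {l. l div m = i + N}) = m"
    using card_block[OF m] by (simp_all add: Collect_conj_eq lessThan_def)
  have "degree (block_similarity m N) (block_stream n m N X Y) j
      = (\<Sum>l<n. of_bool (l = j) + of_bool (j div m = i) * of_bool (l div m = i + N)
          + of_bool (j div m = i + N) * of_bool (l div m = i))"
    unfolding degree_def length_block_stream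
    by (intro sum.cong refl block_similarity_stream) (use assms in auto)
  also have "\<dots> = 1 + of_bool (j div m = i) * m + of_bool (j div m = i + N) * m"
    using assms by (simp add: sum.distrib card flip: sum_distrib_left)
  finally show ?thesis using intersection_less by auto
qed

lemma moment_block:
  assumes "p > 0" "real n \<le> m * (1 + m) powr p"
  shows "moment (block_similarity m N) p (block_stream n m N X Y)
      \<le> 2 * (\<Sum>j | j < n \<and> (j div m = i \<or> j div m = i + N).
                degree (block_similarity m N) (block_stream n m N X Y) j powr p)"
    (is "?M \<le> 2 * sum ?f ?S")
    and "moment (block_similarity m N) p (block_stream n m N X Y) > 0"
proof -
  have "(i + 1) * m \<le> n" using mult_le_mono1[of "i + 1" "2 * N" m] intersection_less N by (auto simp: mult_ac)
  \<comment> \<open>One of the two blocks already outweighs the nodes outside, which are at most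
    \<open>n\<close> and have degree 1.\<close>
  have "m * (1 + m) powr p = (\<Sum>j | j < n \<and> j div m = i. ?f j)"
    using card_block[OF m \<open>(i + 1) * m \<le> n\<close>] by (simp add: degree_block)
  also have "\<dots> \<le> sum ?f ?S"
    by (rule sum_mono2) auto
  finally have big: "m * (1 + m) powr p \<le> sum ?f ?S" .
  have "?M = sum ?f ({..<n} - ?S) + sum ?f ?S"
    unfolding moment_def length_block_stream by (intro sum.subset_diff) auto
  also have "sum ?f ({..<n} - ?S) = (\<Sum>j\<in>{..<n} - ?S. 1)"
    by (intro sum.cong refl) (auto simp: degree_block)
  also have "\<dots> \<le> real n"
    using card_mono[of "{..<n}" "{..<n} - ?S"] by simp
  finally show "?M \<le> 2 * sum ?f ?S" using big assms by linarith
  have "0 < n" using \<open>(i + 1) * m \<le> n\<close> m by (cases n) auto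
  then show "?M > 0"
    unfolding moment_def length_block_stream by (intro sum_pos) (auto simp: degree_block)
qed

end

section \<open>Parameters and asymptotics\<close>

lemma sampler_space_bound:
  fixes n m N s k :: nat
  assumes "p > 0" and samp: "sampler n p \<epsilon> 0.49 A" "\<epsilon> < 0.9"
    and passes: "passes_at_most k A" and space: "space_at_most n (2 * n) A s"
    and m: "m > 0" "2 * m * N \<le> n" "real n \<le> m * (1 + m) powr p"
  shows "real N * (51 / 2000) \<le> 8 + 32 * ((2 * real k + 1) * (real s + 1))"
proof -
  \<comment> \<open>The items are the \<open>j\<close> and the \<open>n + j\<close>, which accounts
    for the universe size \<open>2 * n\<close> in the space bound.\<close>
  define U where "U = {..<2 * n}"
  define f where "f = block_similarity m N"
  define \<sigma> where "\<sigma> = block_stream n m N"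
  \<comment> \<open>Blocks \<open>i\<close> and \<open>i + N\<close> both stand for the index
    \<open>i\<close>, hence the reduction modulo \<open>N\<close>.\<close>
  define gad where "gad z = (case z of None \<Rightarrow> None | Some (j, v) \<Rightarrow> Some (j div m mod N))"
    for z :: "(nat \<times> nat) option"
  define B where "B = {l. length l \<le> s \<and> set l \<subseteq> (UNIV :: bool set)}"
  have f: "similarity U f" by (simp add: f_def similarity_block)
  have \<sigma>: "\<sigma> X Y \<in> streams_of U n" for X Y by (simp add: \<sigma>_def U_def block_stream_in_streams)
  have B: "finite B" "[] \<in> B"
    using finite_lists_length_le[of "UNIV :: bool set" s] by (auto simp: B_def conj_commute)
  have "card B = (\<Sum>i\<le>s. 2 ^ i)"
    using card_lists_length_le[of "UNIV :: bool set" s] by (simp add: B_def conj_commute card_UNIV_bool)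
  also have "\<dots> \<le> 2 ^ (s + 1)"
    by (induction s) auto
  finally have "real (card B) \<le> 2 ^ (s + 1)" by (metis of_nat_le_iff of_nat_numeral of_nat_power)
  moreover have "card B > 0" using B by (auto simp: card_gt_0_iff)
  ultimately have "ln (card B) \<le> ln (2 ^ (s + 1))" by (subst ln_le_cancel_iff) auto
  also have "\<dots> = (s + 1) * ln 2" by (simp only: ln_realpow zero_less_numeral)
  also have "\<dots> \<le> real (s + 1) * 1" using ln_2_less_1 by (intro mult_left_mono) auto
  finally have lnB: "ln (card B) \<le> real s + 1" by simp
  have le: "m * N \<le> n" using m(2) by simp
  have "real (card {..<N}) * (51 / 2000) \<le> 8 + 32 * ((2 * real k + 1) * ln (real (card B)))"
  proof (rule algorithm_search[where \<sigma> = \<sigma> and h = "m * N" and A = A and U = U and f = f and gad = gad])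
    show "passes M \<le> k" if "M \<in> set_pmf (A U f)" for M
      using passes f that unfolding passes_at_most_def by blast
    show "set_pmf (memory M (\<sigma> X Y) t) \<subseteq> B"
      if "M \<in> set_pmf (A U f)" "t \<le> passes M * n" for M X Y t
      using space f \<sigma> that unfolding space_at_most_def B_def by (force simp: U_def)
    show "51 / 2000 \<le> pmf (map_pmf gad (result A U f (\<sigma> X Y))) (Some i)"
      if XY: "X \<subseteq> {..<N}" "Y \<subseteq> {..<N}" "X \<inter> Y = {i}" for X Y i
    proof (rule sampler_hits[OF samp f \<sigma>, where S = "{j. j < n \<and> (j div m = i \<or> j div m = i + N)}"])
      show "gad (Some (j, v)) = Some i" if "j \<in> {j. j < n \<and> (j div m = i \<or> j div m = i + N)}" for j v
        using that XY by (auto simp: gad_def)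
    qed (use moment_block[OF m(1,2) XY \<open>p > 0\<close> m(3)] in \<open>auto simp: f_def \<sigma>_def\<close>)
  qed (use B le in \<open>auto simp: \<sigma>_def nth_block_stream\<close>)
  also have "\<dots> \<le> 8 + 32 * ((2 * real k + 1) * (real s + 1))"
    using lnB by (intro add_left_mono mult_left_mono) auto
  finally show ?thesis by simp
qed

theorem theorem24:
  fixes p :: real and k :: nat
  assumes "p > 0" and "k \<ge> 1"
  shows "\<exists>c>0. \<exists>N. \<forall>n\<ge>N. \<forall>\<epsilon>. 0 < \<epsilon> \<longrightarrow> \<epsilon> < 0.9 \<longrightarrow>
           (\<forall>A s. sampler n p \<epsilon> 0.49 A \<longrightarrow> passes_at_most k A \<longrightarrow> space_at_most n (2 * n) A s \<longrightarrow>
              c * real n powr (1 - 1 / (p + 1)) \<le> real s)"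
proof -
  define K where "K = 32 * (2 * real k + 1)"
  define \<theta> where "\<theta> = (51 / 2000 :: real)"
  have K: "K > 0" by (simp add: K_def)
  have "1 - 1 / (p + 1) > 0" using assms by simp
  then have "filterlim (\<lambda>n. real n powr (1 - 1 / (p + 1))) at_top at_top"
    by real_asymp
  \<comment> \<open>The threshold makes the additive terms \<open>\<theta> + 8 + K\<close> at most
    half of the main term \<open>\<theta> * r / 4\<close> below.\<close>
  then have "\<forall>\<^sub>F n in at_top. 8 * (\<theta> + 8 + K) / \<theta> \<le> real n powr (1 - 1 / (p + 1))"
    unfolding filterlim_at_top by blast
  then obtain n\<^sub>0 where n\<^sub>0: "8 * (\<theta> + 8 + K) / \<theta> \<le> real n powr (1 - 1 / (p + 1))" if "n \<ge> n\<^sub>0" for n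
    unfolding eventually_at_top_linorder by blast
  have bound: "\<theta> / (8 * K) * real n powr (1 - 1 / (p + 1)) \<le> real s"
    if n: "n \<ge> max n\<^sub>0 1" and \<epsilon>: "\<epsilon> < 0.9" and A: "sampler n p \<epsilon> 0.49 A" "passes_at_most k A"
      "space_at_most n (2 * n) A s" for n \<epsilon> A s
  proof -
    define x where "x = real n powr (1 / (p + 1))"
    define r where "r = real n powr (1 - 1 / (p + 1))"
    \<comment> \<open>Since \<open>x powr (p + 1) = n\<close>, this \<open>m\<close> makes a block
      pair heavy enough; rounding up costs at most a factor 2 because
      \<open>x \<ge> 1\<close>.\<close>
    define m where "m = nat \<lceil>x\<rceil>"
    define N where "N = n div (2 * m)"
    have "x \<ge> 1" using n assms by (simp add: x_def ge_one_powr_ge_zero)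
    then have m: "m > 0" "x \<le> m" "m \<le> 2 * x" by (auto simp: m_def) linarith+
    have "1 / (p + 1) + p / (p + 1) = 1" using assms by (simp add: field_simps)
    then have "real n = x * x powr p"
      using n by (simp add: x_def powr_powr flip: powr_add)
    also have "\<dots> \<le> m * (1 + m) powr p"
      using m assms \<open>x \<ge> 1\<close> by (intro mult_mono powr_mono2) auto
    finally have big: "real n \<le> m * (1 + m) powr p" .
    have "2 * m * N \<le> n" by (simp add: N_def)
    from sampler_space_bound[OF assms(1) A(1) \<epsilon> A(2,3) m(1) this big]
    have main: "N * \<theta> \<le> 8 + K * (real s + 1)" by (simp add: K_def \<theta>_def algebra_simps)
    have "n = r * x" using n by (simp add: r_def x_def flip: powr_add)
    have "r * x \<le> (real N + 1) * (2 * real m)"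
    proof -
      have "n < (N + 1) * (2 * m)"
        using m(1) unfolding N_def by (metis Suc_eq_plus1 dividend_less_div_times mult_Suc mult_pos_pos zero_less_numeral add.commute)
      then have "real n \<le> real ((N + 1) * (2 * m))" by linarith
      then show ?thesis using \<open>n = r * x\<close> by (simp add: algebra_simps)
    qed
    also have "\<dots> \<le> (real N + 1) * (2 * (2 * x))"
      using m(3) by (intro mult_left_mono) auto
    finally have "r / 4 \<le> real N + 1" using \<open>x \<ge> 1\<close> by simp
    then have "\<theta> * (r / 4) \<le> \<theta> * (real N + 1)"
      by (intro mult_left_mono) (auto simp: \<theta>_def)
    moreover have "8 * (\<theta> + 8 + K) \<le> \<theta> * r"
      using n\<^sub>0[of n] n by (simp add: \<theta>_def r_def field_simps)
    ultimately have "\<theta> * r \<le> 8 * (K * s)"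
      using main by (simp add: algebra_simps)
    then show ?thesis using K by (simp add: r_def field_simps)
  qed
  have "\<theta> / (8 * K) > 0" using K by (simp add: \<theta>_def)
  with bound show ?thesis by blast
qed

end
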